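(* Let $a$ be a positive integer with $a\equiv 3\pmod{4}$, and let $m$ be the smallest positive integer such that $\frac{a+1}{m}$ is the sum of two squares. If $n$ is an odd positive integer and $a^n+1$ is the sum of two squares, then $n\equiv m \pmod{4}$.
   Context: A number $N$ is "the sum of two squares" if $N = s^2+t^2$ for some integers $s,t$ (zero is allowed); in particular $\frac{a+1}{m}$ must be an integer. *)

theory Defs
  imports "HOL-Number_Theory.Number_Theory"
begin

definition sum_of_two_squares :: "int \<Rightarrow> bool" where
  "sum_of_two_squares N \<longleftrightarrow> (\<exists>s t :: int. N = s\<^sup>2 + t\<^sup>2)"

end

theory Submission
  imports Defs
begin

text \<open>
  Write \<open>a + 1 = m k\<close> with \<open>k\<close> a sum of two squares, and \<open>a\<^sup>n + 1 = (a + 1) S\<close>, where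
  \<open>S = 1 - a + a\<^sup>2 - \<dots> + a\<^bsup>n-1\<^esup>\<close>. The proof computes \<open>S\<close> modulo 4 in two ways.

  On the one hand \<open>-a \<equiv> 1\<close> modulo 4, so all \<open>n\<close> terms of \<open>S\<close> are congruent to 1 and
  \<open>S \<equiv> n\<close>; in particular \<open>S\<close> is odd. On the other hand \<open>S m k = a\<^sup>n + 1\<close> and \<open>k\<close> are both sums of
  two squares, hence so is their product \<open>(S m) k\<^sup>2\<close> by the Brahmagupta--Fibonacci identity.
  A positive odd \<open>N\<close> for which some \<open>N k\<^sup>2\<close> with \<open>k \<noteq> 0\<close> is a sum of two squares is congruent to 1
  modulo 4 (\<open>odd_cong_1_mod_4_if_times_square\<close>): after cancelling common factors, this reduces to
  the fact that \<open>-1\<close> is not a square modulo a prime \<open>p \<equiv> 3\<close>. As \<open>m\<close> is odd, this applies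
  to \<open>N = S m\<close>, and \<open>S m \<equiv> 1\<close> gives \<open>S \<equiv> m\<close>, because odd residues modulo 4 are their own inverses.

  Minimality makes \<open>m\<close> odd: twice a sum of two squares is again one, so an
  even \<open>m\<close> could be replaced by \<open>m / 2\<close>.
\<close>

lemma sum_of_two_squares_mult:
  assumes "sum_of_two_squares M" "sum_of_two_squares N"
  shows "sum_of_two_squares (M * N)"
proof -
  from assms obtain s t u v where "M = s\<^sup>2 + t\<^sup>2" "N = u\<^sup>2 + v\<^sup>2"
    unfolding sum_of_two_squares_def by blast
  then have "M * N = (s * u - t * v)\<^sup>2 + (s * v + t * u)\<^sup>2"
    by (simp add: power2_eq_square algebra_simps)
  then show ?thesis
    unfolding sum_of_two_squares_def by blast
qed

text \<open>
  If \<open>p = 4 j + 3\<close>, then raising \<open>x\<^sup>2 \<equiv> -y\<^sup>2\<close> to the odd power \<open>(p - 1) / 2\<close> gives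
  \<open>x\<^bsup>p-1\<^esup> \<equiv> -y\<^bsup>p-1\<^esup>\<close>, which Fermat's little theorem turns into \<open>1 \<equiv> -1\<close>.
\<close>

lemma prime_dvd_coprime_sum_squares_cong_1_mod_4:
  fixes x y p :: int
  assumes p: "prime p" "odd p" and dvd: "p dvd x\<^sup>2 + y\<^sup>2" and "coprime x y"
  shows "[p = 1] (mod 4)"
proof (rule ccontr)
  assume "\<not> [p = 1] (mod 4)"
  with \<open>odd p\<close> have "p mod 4 = 3"
    unfolding cong_def by presburger
  moreover have "p > 0"
    using p(1) by (rule prime_gt_0_int)
  ultimately have "p = 4 * (p div 4) + 3" "p div 4 \<ge> 0"
    by presburger+
  then have "nat p = 4 * nat (p div 4) + 3"
    by linarith
  then obtain j where j: "nat p = 4 * j + 3" ..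
  have fermat: "[z ^ (nat p - 1) = 1] (mod p)" if "\<not> p dvd z" for z
  proof -
    have "\<not> nat p dvd nat \<bar>z\<bar>"
      using that \<open>p > 0\<close> by (simp add: nat_dvd_iff)
    then have "[nat \<bar>z\<bar> ^ (nat p - 1) = 1] (mod nat p)"
      using p(1) by (intro fermat_theorem) simp_all
    then have "[int (nat \<bar>z\<bar> ^ (nat p - 1)) = int 1] (mod int (nat p))"
      by (simp only: cong_int_iff)
    then have "[\<bar>z\<bar> ^ (nat p - 1) = 1] (mod p)"
      using \<open>p > 0\<close> by simp
    moreover have "even (nat p - 1)"
      using j by simp
    ultimately show ?thesis
      by (simp add: power_even_abs)
  qed
  have "\<not> (p dvd x \<and> p dvd y)"
    using \<open>coprime x y\<close> p(1) by (meson coprime_common_divisor not_prime_unit)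
  then have ndvd: "\<not> p dvd x" "\<not> p dvd y"
    using dvd p(1) by (meson dvd_add_right_iff dvd_add_left_iff prime_dvd_power dvd_power
      pos2 dvd_trans)+
  have exponent: "nat p - 1 = 2 * (2 * j + 1)"
    using j by simp
  have "[x\<^sup>2 = - (y\<^sup>2)] (mod p)"
    using dvd by (simp add: cong_iff_dvd_diff)
  then have "[(x\<^sup>2) ^ (2 * j + 1) = (- (y\<^sup>2)) ^ (2 * j + 1)] (mod p)"
    by (rule cong_pow)
  then have "[x ^ (nat p - 1) = - (y ^ (nat p - 1))] (mod p)"
    unfolding exponent power_mult by simp
  moreover have "[- (y ^ (nat p - 1)) = - 1] (mod p)"
    using fermat[OF ndvd(2)] by (simp add: cong_minus_minus_iff)
  ultimately have "[1 = - 1] (mod p)"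
    using fermat[OF ndvd(1)] by (meson cong_sym cong_trans)
  then have "p dvd 2"
    by (simp add: cong_iff_dvd_diff)
  then have "p \<le> 2"
    by (rule zdvd_imp_le) simp
  then show False
    using j by linarith
qed

lemma cong_1_mod_4_if_prime_divisors:
  fixes d :: int
  assumes "d > 0" and "\<And>p. prime p \<Longrightarrow> p dvd d \<Longrightarrow> [p = 1] (mod 4)"
  shows "[d = 1] (mod 4)"
  using assms
proof (induction d rule: prime_divisors_induct)
  case zero
  then show ?case by simp
next
  case (unit d)
  then show ?case by simp
next
  case (factor p d)
  have "p > 0"
    using factor.hyps by (rule prime_gt_0_int)
  then have "[d = 1] (mod 4)"
    using factor.prems by (intro factor.IH) (auto simp: zero_less_mult_iff)
  moreover have "[p = 1] (mod 4)"
    using factor.hyps factor.prems(2) by simp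
  ultimately show ?case
    using cong_mult[of p 1 4 d 1] by simp
qed

lemma odd_dvd_coprime_sum_squares_cong_1_mod_4:
  fixes x y d :: int
  assumes "d > 0" "odd d" "d dvd x\<^sup>2 + y\<^sup>2" "coprime x y"
  shows "[d = 1] (mod 4)"
  using assms
  by (meson cong_1_mod_4_if_prime_divisors prime_dvd_coprime_sum_squares_cong_1_mod_4 dvd_trans)

text \<open>
  Let \<open>N k\<^sup>2 = x\<^sup>2 + y\<^sup>2\<close> and \<open>d = gcd x y\<close>. Taking \<open>d\<^sup>2\<close> out of the right-hand side and
  cancelling \<open>(gcd k d)\<^sup>2\<close> leaves \<open>N l\<^sup>2 = e\<^sup>2 (u\<^sup>2 + v\<^sup>2)\<close> with \<open>u\<close>, \<open>v\<close> coprime and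
  \<open>l\<close>, \<open>e\<close> coprime. Hence \<open>N = e\<^sup>2 M\<close>, where \<open>e\<^sup>2\<close> is an odd square and \<open>M\<close> is an odd divisor of
  the coprime sum \<open>u\<^sup>2 + v\<^sup>2\<close>; both are congruent to 1.
\<close>

lemma odd_cong_1_mod_4_if_times_square:
  fixes N k :: int
  assumes "N > 0" "odd N" "k \<noteq> 0" and "sum_of_two_squares (N * k\<^sup>2)"
  shows "[N = 1] (mod 4)"
proof -
  from assms(4) obtain x y where xy: "N * k\<^sup>2 = x\<^sup>2 + y\<^sup>2"
    unfolding sum_of_two_squares_def by blast
  have "gcd x y \<noteq> 0"
    using xy \<open>N > 0\<close> \<open>k \<noteq> 0\<close> by auto
  then obtain u v where uv: "x = u * gcd x y" "y = v * gcd x y" "coprime u v"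
    using gcd_coprime_exists by blast
  define d where "d = gcd x y"
  have "gcd k d \<noteq> 0"
    using \<open>k \<noteq> 0\<close> by simp
  then obtain l e where le: "k = l * gcd k d" "d = e * gcd k d" "coprime l e"
    using gcd_coprime_exists by blast
  define g where "g = gcd k d"
  have "g \<noteq> 0"
    unfolding g_def by fact
  have "x = u * (e * g)" "y = v * (e * g)" "k = l * g"
    using uv le unfolding d_def g_def by metis+
  then have "(N * l\<^sup>2) * g\<^sup>2 = (e\<^sup>2 * (u\<^sup>2 + v\<^sup>2)) * g\<^sup>2"
    using xy by (simp add: power_mult_distrib algebra_simps)
  then have eq: "N * l\<^sup>2 = e\<^sup>2 * (u\<^sup>2 + v\<^sup>2)"
    using \<open>g \<noteq> 0\<close> by simp
  have "coprime (e\<^sup>2) (l\<^sup>2)"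
    using le(3) by (simp add: coprime_commute)
  then have "e\<^sup>2 dvd N"
    using eq by (metis coprime_dvd_mult_left_iff dvd_triv_left)
  then obtain M where M: "N = e\<^sup>2 * M" ..
  have "odd e" "odd M"
    using \<open>odd N\<close> M by auto
  have "e\<^sup>2 > 0" "M > 0"
    using \<open>N > 0\<close> M by (auto simp: zero_less_mult_iff)
  then have "M * l\<^sup>2 = u\<^sup>2 + v\<^sup>2"
    using eq M by simp
  then have "[M = 1] (mod 4)"
    using \<open>M > 0\<close> \<open>odd M\<close> uv(3)
    by (metis odd_dvd_coprime_sum_squares_cong_1_mod_4 dvd_triv_left)
  moreover have "[e\<^sup>2 = 1] (mod 4)"
  proof -
    obtain f where "e = 2 * f + 1"
      using \<open>odd e\<close> by (rule oddE)
    then have "e\<^sup>2 - 1 = 4 * (f\<^sup>2 + f)"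
      by (simp add: power2_eq_square algebra_simps)
    then show ?thesis
      by (simp add: cong_iff_dvd_diff)
  qed
  ultimately show ?thesis
    using cong_mult[of "e\<^sup>2" 1 4 M 1] M by simp
qed

lemma odd_cong_if_mult_cong_1_mod_4:
  fixes x y :: int
  assumes "[x * y = 1] (mod 4)" "odd y"
  shows "[x = y] (mod 4)"
proof -
  have "y mod 4 = 1 \<or> y mod 4 = 3"
    using \<open>odd y\<close> by presburger
  moreover have "(x * (y mod 4)) mod 4 = 1"
    using assms(1) by (simp add: cong_def mod_mult_right_eq)
  ultimately show ?thesis
    unfolding cong_def by (elim disjE; simp; presburger)
qed

theorem lemma1p6:
  fixes a m n :: nat
  assumes "a > 0"
    and "[a = 3] (mod 4)"
    and "m = (LEAST k. k > 0 \<and> k dvd a + 1 \<and> sum_of_two_squares (int ((a + 1) div k)))"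
    and "n > 0"
    and "odd n"
    and "sum_of_two_squares (int (a ^ n + 1))"
  shows "[n = m] (mod 4)"
proof -
  let ?P = "\<lambda>k. k > 0 \<and> k dvd a + 1 \<and> sum_of_two_squares (int ((a + 1) div k))"
  have two_squares: "sum_of_two_squares 1" "sum_of_two_squares 2"
    unfolding sum_of_two_squares_def
    by (rule exI[of _ 1], rule exI[of _ 0], simp) (rule exI[of _ 1], rule exI[of _ 1], simp)
  have "?P (a + 1)"
    using two_squares by simp
  then have "?P m"
    unfolding assms(3) by (rule LeastI)
  then obtain k where k: "a + 1 = m * k" and "m > 0" and k_sum: "sum_of_two_squares (int k)"
    by (auto elim!: dvdE)
  have "k > 0"
    using k by (cases k) auto
  have "odd m"
  proof
    assume "even m"
    then obtain h where h: "m = 2 * h" ..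
    have "a + 1 = h * (2 * k)"
      using k h by simp
    moreover have "sum_of_two_squares (int (2 * k))"
      using sum_of_two_squares_mult[OF two_squares(2) k_sum] by simp
    moreover have "h > 0"
      using \<open>m > 0\<close> h by simp
    ultimately have "?P h"
      by simp
    then have "m \<le> h"
      unfolding assms(3) by (rule Least_le)
    then show False
      using h \<open>m > 0\<close> by simp
  qed
  define S :: int where "S = (\<Sum>i<n. (- int a) ^ i)"
  have "(- int a) ^ n - 1 = (- int a - 1) * S"
    unfolding S_def by (rule power_diff_1_eq)
  then have "int (a ^ n + 1) = S * int (a + 1)"
    using \<open>odd n\<close> by (simp add: algebra_simps)
  then have factorization: "int (a ^ n + 1) = S * int m * int k"
    by (simp only: k of_nat_mult mult.assoc)
  have "[int a = int 3] (mod int 4)"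
    using assms(2) by (simp only: cong_int_iff)
  then have "[- int a = 1] (mod 4)"
    unfolding cong_def by simp presburger
  then have "[(- int a) ^ i = 1] (mod 4)" for i
    using cong_pow[of "- int a" 1 4 i] by simp
  then have S_cong_n: "[S = int n] (mod 4)"
    unfolding S_def using cong_sum[of "{..<n}" "\<lambda>i. (- int a) ^ i" "\<lambda>_. 1" 4] by simp
  then have "odd S"
    using \<open>odd n\<close> unfolding cong_def by presburger
  have "S * int m * int k > 0"
    using factorization by (metis of_nat_0_less_iff add_gr_0 less_one)
  then have "S * int m > 0"
    using \<open>k > 0\<close> by (simp add: zero_less_mult_iff)
  moreover have "odd (S * int m)" "int k \<noteq> 0"
    using \<open>odd S\<close> \<open>odd m\<close> \<open>k > 0\<close> by simp_all
  moreover have "sum_of_two_squares (S * int m * (int k)\<^sup>2)"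
    using sum_of_two_squares_mult[OF assms(6) k_sum]
    unfolding factorization by (simp only: power2_eq_square mult.assoc)
  ultimately have "[S * int m = 1] (mod 4)"
    by (rule odd_cong_1_mod_4_if_times_square)
  then have "[S = int m] (mod 4)"
    using \<open>odd m\<close> by (simp add: odd_cong_if_mult_cong_1_mod_4)
  with S_cong_n have "[int n = int m] (mod int 4)"
    by (simp add: cong_def)
  then show ?thesis
    by (simp only: cong_int_iff)
qed

end
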